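(* Let $w=aub$ be a proper Christoffel word with $u=\psi(v)$, and let $(\alpha_0,\alpha_1,\ldots,\alpha_n)$, $n\geq0$, be the integral representation of $v$. Then $$|w|=K[\alpha_0+1,\alpha_1,\ldots,\alpha_{n-1},\alpha_n+1],$$ where for $n=0$ the right-hand side means $K[\alpha_0+1,1]=K[\alpha_0+2]$.
   Context: Let $\mathcal{A}=\{a,b\}$. $w^{(+)}$ is the shortest palindrome having $w$ as a prefix; $\psi(\varepsilon)=\varepsilon$, $\psi(vx)=(\psi(v)x)^{(+)}$. For coprime positive integers $p,q$ with $N=p+q$, the Christoffel word of slope $p/q$ is $x_1\cdots x_N$ with $x_i=a$ if $ip\bmod N>(i-1)p\bmod N$ and $x_i=b$ otherwise; these are the proper Christoffel words, and each is uniquely of the form $a\psi(v)b$. Every $v\in\mathcal{A}^*$ is uniquely written $v=b^{\alpha_0}a^{\alpha_1}b^{\alpha_2}\cdots a^{\alpha_{m-1}}b^{\alpha_m}$ with $m$ even, $\alpha_i>0$ for $1\leq i\leq m-1$, $\alpha_0,\alpha_m\geq0$; its integral representation is $(\alpha_0,\ldots,\alpha_n)$ with $n=m$ if $\alpha_m>0$ and $n=m-1$ otherwise. Continuants are defined by $K[\,]=1$, $K[a_0]=a_0$, and $K[a_0,\ldots,a_n]=a_nK[a_0,\ldots,a_{n-1}]+K[a_0,\ldots,a_{n-2}]$ for $n\geq1$. *)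

theory Defs
  imports Main "HOL-Library.Sublist"
begin

datatype letter = A | B

definition palindrome :: "'a list \<Rightarrow> bool" where
  "palindrome w \<longleftrightarrow> rev w = w"

definition is_pal_closure :: "'a list \<Rightarrow> 'a list \<Rightarrow> bool" where
  "is_pal_closure w p \<longleftrightarrow> palindrome p \<and> prefix w p \<and>
     (\<forall>q. palindrome q \<and> prefix w q \<longrightarrow> length p \<le> length q)"

definition pal_closure :: "'a list \<Rightarrow> 'a list" where
  "pal_closure w = (THE p. is_pal_closure w p)"

lemma ex1_pal_closure: "\<exists>!p. is_pal_closure w p"
proof -
  let ?P = "\<lambda>p. palindrome p \<and> prefix w p"
  have ex: "?P (w @ rev w)" by (simp add: palindrome_def)
  then obtain p where p: "is_pal_closure w p"
    using ex_has_least_nat[of ?P "w @ rev w" length] by (auto simp: is_pal_closure_def)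
  have "q = p" if q: "is_pal_closure w q" for q
  proof -
    have len: "length q = length p"
      using p q unfolding is_pal_closure_def by (meson le_antisym)
    have le: "length p \<le> length (w @ rev w)"
      using p ex unfolding is_pal_closure_def by blast
    have low: "r ! i = w ! i" if "is_pal_closure w r" "i < length w" for r i
      using that unfolding is_pal_closure_def prefix_def by (auto simp: nth_append)
    have pal: "r ! i = r ! (length r - Suc i)" if "is_pal_closure w r" "i < length r" for r i
      using that unfolding is_pal_closure_def palindrome_def by (metis rev_nth)
    show ?thesis
    proof (rule nth_equalityI[OF len])
      fix i assume i: "i < length q"
      show "q ! i = p ! i"
      proof (cases "i < length w")
        case True
        then show ?thesis using low p q by metis
      next
        case False
        then have "length p - Suc i < length w" using i le len by auto
        then show ?thesis using low p q pal[OF p] pal[OF q] i len by metis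
      qed
    qed
  qed
  with p show ?thesis by blast
qed

definition psi :: "'a list \<Rightarrow> 'a list" where
  "psi v = foldl (\<lambda>u x. pal_closure (u @ [x])) [] v"

lemma psi_Nil: "psi [] = []"
  by (simp add: psi_def)

lemma psi_snoc: "psi (v @ [x]) = pal_closure (psi v @ [x])"
  by (simp add: psi_def)

definition christoffel_word :: "nat \<Rightarrow> nat \<Rightarrow> letter list" where
  "christoffel_word p q =
     map (\<lambda>i. if (i * p) mod (p + q) > ((i - 1) * p) mod (p + q) then A else B)
       [1..<Suc (p + q)]"

definition proper_christoffel :: "letter list \<Rightarrow> bool" where
  "proper_christoffel w \<longleftrightarrow>
     (\<exists>p q. 0 < p \<and> 0 < q \<and> coprime p q \<and> w = christoffel_word p q)"

definition alternating_word :: "nat \<Rightarrow> (nat \<Rightarrow> nat) \<Rightarrow> letter list" where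
  "alternating_word m \<alpha> =
     concat (map (\<lambda>i. replicate (\<alpha> i) (if even i then B else A)) [0..<Suc m])"

text \<open>The integral representation of \<open>v\<close> is \<open>(\<alpha> 0, \<dots>, \<alpha> n)\<close>; the values of \<open>\<alpha>\<close> beyond \<open>m\<close> are
  irrelevant.  For the empty word, \<open>m = 0\<close> and \<open>\<alpha> 0 = 0\<close>; the subtraction \<open>m - 1\<close> is
  truncated, so its integral representation is \<open>(0)\<close>, in accordance with \<open>n \<ge> 0\<close>.\<close>

definition integral_representation :: "letter list \<Rightarrow> nat \<Rightarrow> (nat \<Rightarrow> nat) \<Rightarrow> bool" where
  "integral_representation v n \<alpha> \<longleftrightarrow>
     (\<exists>m. even m \<and> (\<forall>i. 1 \<le> i \<and> i \<le> m - 1 \<longrightarrow> 0 < \<alpha> i) \<and>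
          v = alternating_word m \<alpha> \<and>
          n = (if 0 < \<alpha> m then m else m - 1))"

function continuant :: "nat list \<Rightarrow> nat" where
  "continuant [] = 1"
| "continuant [x] = x"
| "continuant (xs @ [x, y]) = y * continuant (xs @ [x]) + continuant xs"
proof -
  fix P :: bool and zs :: "nat list"
  assume *: "zs = [] \<Longrightarrow> P" "\<And>x. zs = [x] \<Longrightarrow> P" "\<And>xs x y. zs = xs @ [x, y] \<Longrightarrow> P"
  show P
  proof (cases zs rule: rev_cases)
    case (snoc ys y)
    then show ?thesis using * by (cases ys rule: rev_cases) auto
  qed (use * in blast)
qed auto
termination by (relation "measure length") auto

end

theory Submission imports Defs
begin

text \<open>The palindromic prefixes of \<open>psi v\<close> are the words \<open>psi v'\<close> with \<open>v'\<close> a prefix of \<open>v\<close>, so the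
  longest palindromic suffix of \<open>psi v @ [x]\<close> is \<open>[x] @ psi v' @ [x]\<close> with \<open>v' @ [x]\<close> the longest
  prefix of \<open>v\<close> ending in \<open>x\<close>, or \<open>[x]\<close> if there is none. This gives a recursion for
  \<open>length (psi v) + 2\<close>, which splits as a sum of two weights, one per letter, both initially 1:
  reading a letter adds its weight to that of the other letter. A block of \<open>\<alpha> i\<close> equal letters
  therefore performs one step of the continuant recursion.\<close>

section \<open>Palindromic closure and longest palindromic suffixes\<close>

lemma is_pal_closure_pal_closure: "is_pal_closure w (pal_closure w)"
  unfolding pal_closure_def by (rule theI'[OF ex1_pal_closure])

lemma pal_closure_eqI: "is_pal_closure w p \<Longrightarrow> pal_closure w = p"
  using ex1_pal_closure is_pal_closure_pal_closure by blast

lemma palindrome_mirror_iff: "palindrome (rev r @ s @ r) \<longleftrightarrow> palindrome s"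
  by (simp add: palindrome_def)

text \<open>If a palindrome \<open>(t @ s) @ r\<close> has \<open>r\<close> no longer than
  \<open>t @ s\<close>, it begins with \<open>rev r\<close>. Cutting \<open>rev r\<close> off
  \<open>t @ s\<close> leaves a palindromic suffix, at most as long as \<open>s\<close>, so
  \<open>r\<close> is at least as long as \<open>t\<close>.\<close>

lemma pal_closure_longest_suffix:
  assumes s: "palindrome s"
    and longest: "\<And>s'. palindrome s' \<Longrightarrow> suffix s' (t @ s) \<Longrightarrow> length s' \<le> length s"
  shows "pal_closure (t @ s) = t @ s @ rev t"
proof (rule pal_closure_eqI)
  have "length (t @ s @ rev t) \<le> length q" if q: "palindrome q" "prefix (t @ s) q" for q
  proof -
    obtain r where r: "q = (t @ s) @ r" using q(2) by (auto elim: prefixE)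
    show ?thesis
    proof (cases "length r \<le> length (t @ s)")
      case True
      have "rev r @ rev (t @ s) = (t @ s) @ r"
        using q(1) r by (simp add: palindrome_def)
      then have "prefix (rev r) (t @ s)"
        using True by (metis length_rev prefixI prefix_length_prefix)
      then obtain s' where s': "t @ s = rev r @ s'" by (auto elim: prefixE)
      then have "palindrome s'"
        using q(1) r palindrome_mirror_iff[of r s'] by simp
      then have "length s' \<le> length s" using longest s' by (simp add: suffix_def)
      moreover have "length t + length s = length r + length s'"
        using arg_cong[OF s', of length] by simp
      ultimately show ?thesis using r by simp
    qed (use r in simp)
  qed
  then show "is_pal_closure (t @ s) (t @ s @ rev t)"
    using s by (simp add: is_pal_closure_def palindrome_def)
qed

section \<open>Palindromic prefixes and suffixes of iterated closures\<close>

lemma palindrome_psi: "palindrome (psi v)"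
proof (cases v rule: rev_cases)
  case (snoc v' x)
  then show ?thesis
    using is_pal_closure_pal_closure[of "psi v' @ [x]"] by (simp add: psi_snoc is_pal_closure_def)
qed (simp add: psi_Nil palindrome_def)

lemma prefix_psi_snoc: "prefix (psi v @ [x]) (psi (v @ [x]))"
  using is_pal_closure_pal_closure[of "psi v @ [x]"] by (simp add: psi_snoc is_pal_closure_def)

lemma prefix_psi_append: "prefix (psi v) (psi (v @ v'))"
proof (induction v' rule: rev_induct)
  case (snoc x v')
  then show ?case
    using prefix_psi_snoc[of "v @ v'" x] by (metis append_assoc append_prefixD prefix_order.trans)
qed simp

lemma prefix_psi_mono: "prefix v v' \<Longrightarrow> prefix (psi v) (psi v')"
  by (auto elim!: prefixE simp: prefix_psi_append)

text \<open>Minimality of the closure is the reason: a palindromic prefix of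
  \<open>psi (v @ [x])\<close> longer than \<open>psi v\<close> extends \<open>psi v @ [x]\<close>
  and so is already the whole word.\<close>

lemma palindromic_prefix_psi:
  assumes "palindrome p" "prefix p (psi v)"
  obtains v' where "prefix v' v" "p = psi v'"
  using assms
proof (induction v arbitrary: thesis rule: rev_induct)
  case Nil
  then show ?case by (simp add: psi_Nil)
next
  case (snoc x v)
  show ?case
  proof (cases "length p \<le> length (psi v)")
    case True
    have "prefix p (psi v)"
      using True snoc.prems(3) prefix_psi_append prefix_length_prefix by blast
    show ?thesis
    proof (rule snoc.IH[OF _ snoc.prems(2) \<open>prefix p (psi v)\<close>])
      fix v' assume "prefix v' v" "p = psi v'"
      then show thesis using snoc.prems(1)[of v'] by simp
    qed
  next
    case False
    then have "prefix (psi v @ [x]) p"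
      by (intro prefix_length_prefix[OF prefix_psi_snoc snoc.prems(3)]) simp
    then have "length (psi (v @ [x])) \<le> length p"
      using is_pal_closure_pal_closure[of "psi v @ [x]"] snoc.prems(2)
      by (simp add: psi_snoc is_pal_closure_def)
    then have "p = psi (v @ [x])"
      by (intro prefix_order.antisym[OF snoc.prems(3)]
          prefix_length_prefix[OF prefix_order.refl snoc.prems(3)])
    then show ?thesis using snoc.prems(1) by blast
  qed
qed

lemma palindromic_suffix_psi_snoc:
  assumes "palindrome s" "suffix s (psi v @ [x])"
  shows "length s \<le> 1 \<or> (\<exists>v'. prefix (v' @ [x]) v \<and> s = [x] @ psi v' @ [x])"
proof (cases "length s \<le> 1")
  case False
  obtain t where t: "s = t @ [x]" "suffix t (psi v)"
    using assms(2) False by (auto simp: suffix_snoc)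
  then obtain y s' where ys: "t = y # s'" using False by (cases t) auto
  have "hd s = y" "hd (rev s) = x" by (simp_all add: t(1) ys)
  then have yx: "y = x" using assms(1) by (simp add: palindrome_def)
  then have s': "palindrome s'"
    using assms(1) palindrome_mirror_iff[of "[x]" s'] by (simp add: t(1) ys)
  \<comment> \<open>\<open>x # s'\<close> is a suffix of the palindrome \<open>psi v\<close>;
    reversal turns it into a prefix.\<close>
  have s'x: "prefix (s' @ [x]) (psi v)"
    using t(2) ys yx s' palindrome_psi[of v] by (simp add: suffix_to_prefix palindrome_def)
  obtain v' where v': "prefix v' v" "s' = psi v'"
    by (rule palindromic_prefix_psi[OF s' append_prefixD[OF s'x]])
  then have p: "prefix (psi v' @ [x]) (psi v)" using s'x by simp
  then have "v' \<noteq> v" by (auto dest: prefix_length_le)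
  \<comment> \<open>The letter \<open>z\<close> following \<open>v'\<close> in \<open>v\<close> also
    follows \<open>psi v'\<close> in \<open>psi v\<close>, where \<open>x\<close> stands.\<close>
  then obtain z r where "v = v' @ z # r"
    using v'(1) by (metis append.right_neutral neq_Nil_conv prefixE)
  then have z: "prefix (v' @ [z]) v" by simp
  then have "prefix (psi v' @ [z]) (psi v)"
    by (rule prefix_order.trans[OF prefix_psi_snoc prefix_psi_mono])
  then have "z = x" using p by (auto simp: prefix_def)
  moreover have "s = [x] @ psi v' @ [x]" by (simp add: t(1) ys yx v'(2))
  ultimately show ?thesis using z by blast
qed simp

section \<open>Length recursion\<close>

lemma length_psi_snoc_new:
  assumes "x \<notin> set v"
  shows "length (psi (v @ [x])) = 2 * length (psi v) + 1"
proof -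
  have "length s \<le> length [x]" if "palindrome s" "suffix s (psi v @ [x])" for s
    using palindromic_suffix_psi_snoc[OF that] assms by (auto dest: set_mono_prefix)
  then show ?thesis
    using pal_closure_longest_suffix[of "[x]" "psi v"] by (simp add: psi_snoc palindrome_def)
qed

text \<open>\<open>v1 @ [x]\<close> is the longest prefix of \<open>v\<close> ending in
  \<open>x\<close>, so the closure reflects \<open>psi v @ [x]\<close> about the centre of its
  suffix \<open>[x] @ psi v1 @ [x]\<close>.\<close>

lemma length_psi_snoc_old:
  assumes v: "v = v1 @ [x] @ v2" and "x \<notin> set v2"
  shows "length (psi (v @ [x])) + length (psi v1) = 2 * length (psi v)"
proof -
  let ?s = "[x] @ psi v1 @ [x]"
  have s: "palindrome ?s" using palindrome_psi[of v1] by (simp add: palindrome_def)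
  have "prefix (psi v1 @ [x]) (psi v)"
    using prefix_psi_snoc[of v1 x] prefix_psi_append[of "v1 @ [x]" v2] v
    by (metis append_assoc prefix_order.trans)
  then have "suffix ([x] @ psi v1) (psi v)"
    using palindrome_psi[of v] palindrome_psi[of v1] by (simp add: suffix_to_prefix palindrome_def)
  then obtain t where t: "psi v = t @ [x] @ psi v1" by (auto simp: suffix_def)
  have "length s \<le> length ?s" if pal: "palindrome s" and suf: "suffix s (t @ ?s)" for s
  proof -
    have "suffix s (psi v @ [x])" using suf t by simp
    from palindromic_suffix_psi_snoc[OF pal this] show ?thesis
    proof (elim disjE exE conjE)
      fix v' assume v': "prefix (v' @ [x]) v" "s = [x] @ psi v' @ [x]"
      then obtain r where r: "v1 @ x # v2 = v' @ x # r" using v by (auto simp: prefix_def)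
      \<comment> \<open>As \<open>x\<close> does not occur in \<open>v2\<close>, the
        \<open>x\<close> after \<open>v'\<close> is not to the right of the one after
        \<open>v1\<close>.\<close>
      have "prefix v' v1"
        using r assms(2) by (auto simp: append_eq_append_conv2 Cons_eq_append_conv)
      then show ?thesis using v'(2) prefix_psi_mono prefix_length_le by fastforce
    qed simp
  qed
  from pal_closure_longest_suffix[OF s this] show ?thesis
    using t by (simp add: psi_snoc)
qed

text \<open>For a letter not occurring in \<open>v\<close> the value 1 makes \<open>length_psi_snoc\<close> hold uniformly.\<close>

definition last_length :: "'a \<Rightarrow> 'a list \<Rightarrow> nat" where
  "last_length x v = (case dropWhile (\<lambda>y. y \<noteq> x) (rev v) of
     [] \<Rightarrow> 1 | _ # ys \<Rightarrow> length (psi (rev ys)) + 2)"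

lemma last_length_simps [simp]:
  "last_length x [] = 1"
  "last_length x (v @ [y]) = (if y = x then length (psi v) + 2 else last_length x v)"
  by (simp_all add: last_length_def)

lemma length_psi_snoc:
  "length (psi (v @ [x])) + 2 + last_length x v = 2 * (length (psi v) + 2)"
proof (cases "x \<in> set v")
  case True
  then obtain v1 v2 where v: "v = v1 @ [x] @ v2" "x \<notin> set v2"
    by (auto dest!: split_list_last)
  have "dropWhile (\<lambda>y. y \<noteq> x) (rev v2 @ x # rev v1) = x # rev v1"
    using v(2) by (subst dropWhile_append2) auto
  then have "last_length x (v1 @ [x] @ v2) = length (psi v1) + 2"
    by (simp add: last_length_def)
  then show ?thesis using length_psi_snoc_old[OF v] v(1) by simp
next
  case False
  then have "last_length x v = 1" by (induction v rule: rev_induct) auto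
  then show ?thesis using length_psi_snoc_new[OF False] by simp
qed

section \<open>Letter weights and continuants\<close>

text \<open>If \<open>y\<close> occurs in \<open>v\<close>, this is a period of
  \<open>psi v\<close>: its length minus that of the border \<open>psi v1\<close>, where
  \<open>v1 @ [y]\<close> is the longest prefix of \<open>v\<close> ending in
  \<open>y\<close>.\<close>

definition weight :: "letter list \<Rightarrow> letter \<Rightarrow> nat" where
  "weight v = foldl (\<lambda>f x y. if y = x then f x else f A + f B) (\<lambda>_. 1) v"

lemma weight_simps [simp]:
  "weight [] y = 1"
  "weight (v @ [x]) y = (if y = x then weight v x else weight v A + weight v B)"
  by (simp_all add: weight_def)

text \<open>The equations support each other in the induction. With
  \<open>L = length (psi v) + 2\<close>, \<open>length_psi_snoc\<close> and the equation for
  \<open>x\<close> make the new length plus 2 equal to \<open>L + weight v x\<close>; the new last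
  length of \<open>x\<close> and the new weight of the other letter are both
  \<open>L\<close>.\<close>

lemma weight_last_length:
  "weight v A + weight v B = length (psi v) + 2"
  "weight v A + last_length A v = length (psi v) + 2"
  "weight v B + last_length B v = length (psi v) + 2"
proof (induction v rule: rev_induct)
  case Nil
  show "weight [] A + weight [] B = length (psi []) + 2"
    "weight [] A + last_length A [] = length (psi []) + 2"
    "weight [] B + last_length B [] = length (psi []) + 2"
    by (simp_all add: psi_Nil)
next
  case (snoc x v)
  show "weight (v @ [x]) A + weight (v @ [x]) B = length (psi (v @ [x])) + 2"
    "weight (v @ [x]) A + last_length A (v @ [x]) = length (psi (v @ [x])) + 2"
    "weight (v @ [x]) B + last_length B (v @ [x]) = length (psi (v @ [x])) + 2"
    using snoc length_psi_snoc[of v x] by (cases x; simp)+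
qed

lemma weight_append_replicate:
  "weight (v @ replicate k x) y = (if y = x then weight v x else weight v y + k * weight v x)"
proof (induction k arbitrary: y)
  case (Suc k)
  have "weight (v @ replicate (Suc k) x) y = weight ((v @ replicate k x) @ [x]) y"
    by (simp add: replicate_append_same)
  then show ?case
    using Suc[of A] Suc[of B] by (cases x; cases y; simp del: append_assoc)
qed simp

text \<open>\<open>c i\<close> is the letter of block \<open>i\<close>, and \<open>\<beta>\<close>
  absorbs the initial weight 1 of \<open>A\<close> into the first entry.\<close>

lemma weight_alternating_word:
  fixes \<alpha> :: "nat \<Rightarrow> nat"
  defines "c \<equiv> \<lambda>i::nat. if even i then B else A"
    and "\<beta> \<equiv> \<alpha>(0 := \<alpha> 0 + 1)"
  shows "weight (alternating_word i \<alpha>) (c i) = continuant (map \<beta> [0..<i]) \<and>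
    weight (alternating_word i \<alpha>) (c (Suc i)) = continuant (map \<beta> [0..<Suc i])"
proof (induction i)
  case 0
  then show ?case
    using weight_append_replicate[of "[]" "\<alpha> 0" B]
    by (simp add: alternating_word_def c_def \<beta>_def)
next
  case (Suc i)
  have "alternating_word (Suc i) \<alpha> = alternating_word i \<alpha> @ replicate (\<alpha> (Suc i)) (c (Suc i))"
    by (simp add: alternating_word_def c_def)
  \<comment> \<open>The letters swap roles: the new block adds \<open>\<alpha> (Suc i)\<close> times
    the weight of \<open>c (Suc i)\<close> to that of \<open>c i\<close>.\<close>
  moreover have "c (Suc (Suc i)) = c i" "c i \<noteq> c (Suc i)" by (simp_all add: c_def)
  ultimately show ?case
    using Suc continuant.simps(3)[of "map \<beta> [0..<i]" "\<beta> i" "\<beta> (Suc i)"]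
    by (simp add: weight_append_replicate \<beta>_def)
qed

lemma length_psi_alternating_word:
  assumes "n > 0"
  shows "length (psi (alternating_word n \<alpha>)) + 2 =
    continuant ([\<alpha> 0 + 1] @ map \<alpha> [1..<n] @ [\<alpha> n + 1])"
proof -
  define \<beta> where "\<beta> = \<alpha>(0 := \<alpha> 0 + 1)"
  obtain k where k: "n = Suc k" using assms by (cases n) auto
  let ?xs = "map \<beta> [0..<k]"
  have "length (psi (alternating_word n \<alpha>)) + 2 =
      continuant (map \<beta> [0..<n]) + continuant (map \<beta> [0..<Suc n])"
    using weight_last_length(1)[of "alternating_word n \<alpha>"] weight_alternating_word[of n \<alpha>]
    by (auto simp: \<beta>_def split: if_splits)
  \<comment> \<open>A continuant is affine in its last entry, with slope the continuant of the
    preceding entries; adding the shorter continuant thus raises the last entry by 1.\<close>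
  also have "\<dots> = continuant (?xs @ [\<beta> k, \<alpha> n + 1])"
    using continuant.simps(3)[of ?xs "\<beta> k" "\<alpha> n"] continuant.simps(3)[of ?xs "\<beta> k" "\<alpha> n + 1"]
    by (simp add: k \<beta>_def)
  also have "?xs @ [\<beta> k, \<alpha> n + 1] = map \<beta> [0..<n] @ [\<alpha> n + 1]" by (simp add: k)
  also have "map \<beta> [0..<n] = [\<alpha> 0 + 1] @ map \<alpha> [1..<n]"
    using assms by (simp add: upt_conv_Cons \<beta>_def)
  finally show ?thesis by simp
qed

theorem theorem5p2:
  fixes w u v :: "letter list" and n :: nat and \<alpha> :: "nat \<Rightarrow> nat"
  assumes "proper_christoffel w"
    and "w = [A] @ u @ [B]"
    and "u = psi v"
    and "integral_representation v n \<alpha>"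
  shows "if n = 0
         then length w = continuant [\<alpha> 0 + 1, 1] \<and>
              continuant [\<alpha> 0 + 1, 1] = continuant [\<alpha> 0 + 2]
         else length w = continuant ([\<alpha> 0 + 1] @ map \<alpha> [1..<n] @ [\<alpha> n + 1])"
proof -
  obtain m where m: "even m" "v = alternating_word m \<alpha>" "n = (if 0 < \<alpha> m then m else m - 1)"
    using assms(4) by (auto simp: integral_representation_def)
  \<comment> \<open>If \<open>\<alpha> m = 0\<close> and \<open>m > 0\<close>, the last block is
    empty and \<open>n = m - 1\<close>, so dropping it keeps the word.\<close>
  have v: "v = alternating_word n \<alpha>"
  proof (cases "0 < \<alpha> m \<or> m = 0")
    case False
    then show ?thesis using m by (cases m) (auto simp: alternating_word_def)
  qed (use m in auto)
  have len: "length w = length (psi v) + 2" using assms(2,3) by simp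
  show ?thesis
  proof (cases "n = 0")
    case True
    \<comment> \<open>Here the weights of \<open>A\<close> and \<open>B\<close> are
      \<open>\<alpha> 0 + 1\<close> and 1.\<close>
    have "length w = continuant [\<alpha> 0 + 1] + 1"
      using len v True weight_last_length(1)[of v] weight_alternating_word[of 0 \<alpha>] by simp
    then show ?thesis using True continuant.simps(3)[of "[]" "\<alpha> 0 + 1" 1] by simp
  next
    case False
    then show ?thesis using len v length_psi_alternating_word[of n \<alpha>] by simp
  qed
qed

end
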